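(* Suppose there is a positive integer $\bar r$ such that for every $r\ge\bar r$ the set $\mathcal{M}_r$ is non-empty and satisfies LICQ at every $R\in\mathcal{M}_r$, and let $r\ge\bar r$. Let $(R;\lambda,\mu)\in\mathbb{R}^{n\times r}\times\mathbb{R}^{m\times r}\times\mathbb{R}^{|B|}$ satisfy the KKT conditions $$2LR+q e_1^\top-A^\top\lambda=0,\qquad AR=be_1^\top,\qquad \operatorname{diag}_B(RR^\top)-R_Be_1=0$$ of $\min\{f_r(R):R\in\mathcal{M}_r\}$, where $W:=\sigma\Pi_{\mathcal P^*}(\sigma^{-1}\widetilde W-\widehat R\widehat R^\top)$, $L:=Q-\operatorname{diag}_B^*(\mu)-W_{22}$, $q:=2c+\operatorname{diag}_B^*(\mu)e-2W_{21}$. Let $A^\dagger:=A^\top(AA^\top)^{-1}$, $J_A:=I-A^\dagger A$ and $$S:=\begin{pmatrix}-(Re_1)^\top \\ I\end{pmatrix}J_ALJ_A\begin{pmatrix}-Re_1& I\end{pmatrix}\in\mathbb{S}^{n+1}$$ be the recovered dual variable. Let $\tau$ be a positive integer and let $V\in\mathbb{R}^{(n+1)\times\tau}$ be a matrix whose columns are eigenvectors of $S$ corresponding to negative eigenvalues. Then $$U:=\big[\,0_{n\times r},\ J_A\begin{pmatrix}-Re_1&I\end{pmatrix}V\,\big]\in\mathbb{R}^{n\times(r+\tau)}$$ is a descent direction at the point $P:=[R,0_{n\times\tau}]\in\mathcal{M}_{r+\tau}$ for the problem $\min\{f_{r+\tau}(R'):R'\in\mathcal{M}_{r+\tau}\}$;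 namely, for some $\beta<0$, $$f_{r+\tau}\big(\operatorname{Rtr}_P(tU)\big)=f_r(R)+\beta t^2+o(t^2)\qquad (t\to0).$$
   Context: Data: $n,m$ are positive integers, $Q\in\mathbb{S}^n$ (real symmetric $n\times n$ matrices), $c\in\mathbb{R}^n$, $A\in\mathbb{R}^{m\times n}$ has full row rank, $b\in\mathbb{R}^m$ with $b\ge0$, $B\subseteq[n]$, $C=\begin{pmatrix}0&c^\top \\ c&Q\end{pmatrix}$, $\sigma>0$, $\widetilde W\in\mathbb{S}^{n+1}$, and $\mathcal P\subseteq\mathbb{S}^{n+1}$ is a polyhedral convex cone with dual cone $\mathcal P^*=\{X:\langle X,Y\rangle\ge0\ \forall Y\in\mathcal P\}$. $\langle X,Y\rangle=\operatorname{Tr}(XY^\top)$; $\Pi_{\mathcal C}$ is the orthogonal projection onto a closed convex set $\mathcal C$. Notation: $e$ is the all-ones vector, $e_1$ the first standard unit vector of appropriate dimension (of $\mathbb{R}^r$ in objects indexed by $r$). $\operatorname{diag}_B(X)=(X_{ii})_{i\in B}$, with adjoint $\operatorname{diag}_B^*(\mu)\in\mathbb{R}^{n\times n}$, the diagonal matrix with the entries of $\mu$ at positions in $B$ and $0$ elsewhere. $R_B$ is the submatrix of rows of $R$ indexed by $B$. $\widehat R:=\begin{pmatrix}e_1^\top \\ R\end{pmatrix}$. For $X\in\mathbb{S}^{n+1}$, $X_{11}\in\mathbb{R}$, $X_{21}\in\mathbb{R}^n$, $X_{22}\in\mathbb{S}^n$ denote the blocks of $X=\begin{pmatrix}X_{11}&X_{12}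 \\ X_{21}&X_{22}\end{pmatrix}$. For every $r\geq 1$: $f_r(R)=\langle C,\widehat R\widehat R^\top\rangle+\frac{\sigma}{2}\|\Pi_{\mathcal P^*}(\sigma^{-1}\widetilde W-\widehat R\widehat R^\top)\|^2$ for $R\in\mathbb{R}^{n\times r}$, and $\mathcal{M}_r=\{R\in\mathbb{R}^{n\times r}: AR=be_1^\top,\ \operatorname{diag}_B(RR^\top)=R_Be_1\}$. LICQ at $R\in\mathcal{M}_r$ means that the gradients at $R$ of the $mr+|B|$ scalar constraint functions defining $\mathcal{M}_r$ are linearly independent; under LICQ everywhere, $\mathcal{M}_r$ is an embedded submanifold of $\mathbb{R}^{n\times r}$. $\operatorname{Rtr}_P(H)$ denotes the metric-projection retraction on $\mathcal{M}_{r+\tau}$, i.e. $\operatorname{Rtr}_P(H)$ is the point of $\mathcal{M}_{r+\tau}$ closest in Frobenius norm to $P+H$ (well defined for $H$ small). *)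

theory Defs
  imports "HOL-Analysis.Analysis"
begin

text \<open>
  The number of columns varies within the statement, so a matrix in $\mathbb{R}^{n\times r}$
  is represented by the sequence of its columns, numbered from \<open>0\<close> and padded with zero columns;
  thus \<open>R 0\<close> is $R e_1$ and \<open>A *v R j\<close> is column \<open>j\<close> of $AR$.
  Square matrices of order $n+1$ are indexed by \<open>'n option\<close>,
  where \<open>None\<close> is the leading index and \<open>Some i\<close> ranges over the remaining $n$ indices.
  On the types \<open>real^'a^'b\<close>, \<open>inner\<close> is the trace inner product and \<open>norm\<close> the Frobenius norm.
\<close>

definition mats :: "nat \<Rightarrow> (nat \<Rightarrow> real^'n) set" where
  "mats r = {R. \<forall>j\<ge>r. R j = 0}"

text \<open>The matrix $[X, Y]$, where $X$ has \<open>r\<close> columns.\<close>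

definition hcat :: "nat \<Rightarrow> (nat \<Rightarrow> real^'n) \<Rightarrow> (nat \<Rightarrow> real^'n) \<Rightarrow> nat \<Rightarrow> real^'n" where
  "hcat r X Y = (\<lambda>j. if j < r then X j else Y (j - r))"

text \<open>The matrix $RR^\top$.\<close>

definition gram :: "nat \<Rightarrow> (nat \<Rightarrow> real^'n) \<Rightarrow> real^'n^'n" where
  "gram r R = (\<chi> i k. \<Sum>j<r. R j $ i * R j $ k)"

text \<open>The matrix $\widehat R$, obtained from \<open>R\<close> by adding the leading row $e_1^\top$.\<close>

definition hat :: "(nat \<Rightarrow> real^'n) \<Rightarrow> nat \<Rightarrow> real^('n option)" where
  "hat R = (\<lambda>j. \<chi> k. case k of None \<Rightarrow> (if j = 0 then 1 else 0) | Some i \<Rightarrow> R j $ i)"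

text \<open>Blocks $X_{21}$ and $X_{22}$ of a matrix of order $n+1$.\<close>

definition block21 :: "real^('n option)^('n option) \<Rightarrow> real^'n" where
  "block21 X = (\<chi> i. X $ Some i $ None)"

definition block22 :: "real^('n option)^('n option) \<Rightarrow> real^'n^'n" where
  "block22 X = (\<chi> i k. X $ Some i $ Some k)"

definition cost_mat :: "real^'n^'n \<Rightarrow> real^'n \<Rightarrow> real^('n option)^('n option)" where
  "cost_mat Q c = (\<chi> i k. case (i, k) of
      (None, None) \<Rightarrow> 0
    | (None, Some k') \<Rightarrow> c $ k'
    | (Some i', None) \<Rightarrow> c $ i'
    | (Some i', Some k') \<Rightarrow> Q $ i' $ k')"

text \<open>
  A vector $\mu\in\mathbb{R}^{|B|}$ is a function on the index type whose values outside \<open>B\<close>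
  are irrelevant.
\<close>

definition diag_adj :: "'n set \<Rightarrow> ('n \<Rightarrow> real) \<Rightarrow> real^'n^'n" where
  "diag_adj B \<mu> = (\<chi> i k. if i = k \<and> i \<in> B then \<mu> i else 0)"

text \<open>The dual cone is taken within the space of symmetric matrices.\<close>

definition dual_cone :: "(real^'k^'k) set \<Rightarrow> (real^'k^'k) set" where
  "dual_cone K = {X. transpose X = X \<and> (\<forall>Y\<in>K. inner X Y \<ge> 0)}"

definition objective ::
  "real^'n^'n \<Rightarrow> real^'n \<Rightarrow> real \<Rightarrow> real^('n option)^('n option) \<Rightarrow> (real^('n option)^('n option)) set
    \<Rightarrow> nat \<Rightarrow> (nat \<Rightarrow> real^'n) \<Rightarrow> real" where
  "objective Q c \<sigma> Wt K r R =
     inner (cost_mat Q c) (gram r (hat R))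
     + \<sigma> / 2 * (norm (closest_point (dual_cone K) (inverse \<sigma> *\<^sub>R Wt - gram r (hat R))))\<^sup>2"

definition feasible :: "real^'n^'m \<Rightarrow> real^'m \<Rightarrow> 'n set \<Rightarrow> nat \<Rightarrow> (nat \<Rightarrow> real^'n) set" where
  "feasible A b B r = {R \<in> mats r.
     (\<forall>j<r. A *v R j = (if j = 0 then b else 0)) \<and>
     (\<forall>i\<in>B. gram r R $ i $ i = R 0 $ i)}"

text \<open>
  The scalar constraints: \<open>Inl (k, j)\<close> is entry \<open>(k, j)\<close> of $AR - be_1^\top$,
  and \<open>Inr i\<close> is entry \<open>i\<close> of $\mathrm{diag}_B(RR^\top) - R_Be_1$.
\<close>

definition constr_index :: "'n set \<Rightarrow> nat \<Rightarrow> (('m \<times> nat) + 'n) set" where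
  "constr_index B r = (UNIV \<times> {..<r}) <+> B"

definition constr ::
  "real^'n^'m \<Rightarrow> real^'m \<Rightarrow> nat \<Rightarrow> ('m \<times> nat) + 'n \<Rightarrow> (nat \<Rightarrow> real^'n) \<Rightarrow> real" where
  "constr A b r s R = (case s of
      Inl (k, j) \<Rightarrow> (A *v R j) $ k - (if j = 0 then b $ k else 0)
    | Inr i \<Rightarrow> gram r R $ i $ i - R 0 $ i)"

text \<open>
  The gradient on $\mathbb{R}^{n\times r}$ is the matrix of partial derivatives; entry \<open>(i, j)\<close>
  is the derivative along the matrix unit $E_{ij}$.
\<close>

definition gradient ::
  "nat \<Rightarrow> ((nat \<Rightarrow> real^'n) \<Rightarrow> real) \<Rightarrow> (nat \<Rightarrow> real^'n) \<Rightarrow> nat \<Rightarrow> real^'n" where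
  "gradient r g R = (\<lambda>j. \<chi> i.
     if j < r then deriv (\<lambda>t. g (R(j := R j + t *\<^sub>R axis i 1))) 0 else 0)"

text \<open>Linear independence of the gradients as an indexed family.\<close>

definition LICQ :: "real^'n^'m \<Rightarrow> real^'m \<Rightarrow> 'n set \<Rightarrow> nat \<Rightarrow> (nat \<Rightarrow> real^'n) \<Rightarrow> bool" where
  "LICQ A b B r R \<longleftrightarrow>
     (\<forall>a. (\<forall>j. (\<Sum>s\<in>constr_index B r. a s *\<^sub>R gradient r (constr A b r s) R j) = 0)
        \<longrightarrow> (\<forall>s\<in>constr_index B r. a s = 0))"

definition frob_dist :: "nat \<Rightarrow> (nat \<Rightarrow> real^'n) \<Rightarrow> (nat \<Rightarrow> real^'n) \<Rightarrow> real" where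
  "frob_dist r X Y = L2_set (\<lambda>j. dist (X j) (Y j)) {..<r}"

text \<open>
  Metric-projection retraction on \<open>M\<close>. As with \<open>closest_point\<close>, a minimizer is selected if there
  are several; for small \<open>H\<close> the minimizer on an embedded submanifold is unique.
\<close>

definition retr ::
  "nat \<Rightarrow> (nat \<Rightarrow> real^'n) set \<Rightarrow> (nat \<Rightarrow> real^'n) \<Rightarrow> (nat \<Rightarrow> real^'n) \<Rightarrow> nat \<Rightarrow> real^'n" where
  "retr r M P H = arg_min_on (\<lambda>X. frob_dist r X (\<lambda>j. P j + H j)) M"

definition pinv :: "real^'n^'m \<Rightarrow> real^'m^'n" where
  "pinv A = transpose A ** matrix_inv (A ** transpose A)"

definition null_proj :: "real^'n^'m \<Rightarrow> real^'n^'n" where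
  "null_proj A = mat 1 - pinv A ** A"

text \<open>The $n\times(n+1)$ matrix $(-x \;\; I)$.\<close>

definition neg_id :: "real^'n \<Rightarrow> real^('n option)^'n" where
  "neg_id x = (\<chi> i k. case k of None \<Rightarrow> - x $ i | Some j \<Rightarrow> mat 1 $ i $ j)"

end

theory Submission
  imports Defs "HOL-Real_Asymp.Real_Asymp"
begin

text \<open>
  Let $E = X - P$ for a feasible point $X$ with $r+\tau$ columns, and let
  $\Delta = \widehat X\widehat X^\top - \widehat P\widehat P^\top$. The objective depends on $X$ only
  through this Gram matrix, in a linear way apart from the penalty
  $\frac{\sigma}{2}\|\Pi(\sigma^{-1}\widetilde W - \cdot)\|^2$. Half the squared norm of the projection
  onto a closed convex cone has the projection as its gradient, with a remainder of at most the
  squared increment (\<open>half_norm_closest_point_cone_expansion\<close>). Therefore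
  $f(X) - f(P) = \langle C - W, \Delta\rangle + O(\|\Delta\|^2)$ (\<open>objective_expansion\<close>).

  The first term is exactly quadratic. The point $P$ inherits the KKT conditions from $R$, with $\lambda$
  padded by zero columns. Since the constraints are at most quadratic, feasibility of
  $X$ and $P$ turns the multiplier terms in the stationarity condition into second-order ones, and
  $\langle C - W, \Delta\rangle = \sum_j E_j^\top L E_j$ (\<open>objective_linear_part_KKT\<close>).

  The second term is negligible along $U$. Only the first $r$ columns of
  $\widehat P$ and only the last $\tau$ columns of $U$ can be nonzero, so $\widehat P U^\top = 0$ and a displacement
  $E = tU + O(t^2)$ gives
  $\Delta = O(t^2)$ only (\<open>gram_hat_expansion_smallo\<close> records the weaker $o(t)$, which suffices).
  What remains is $f(X) = f(P) + t^2 \sum_j U_j^\top L U_j + o(t^2)$, and by the definition of $S$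
  the coefficient is $\sum_j V_j^\top S V_j = \sum_j \theta_j \|V_j\|^2 < 0$, where $\theta_j$ is
  the eigenvalue belonging to $V_j$.

  It remains to see that the retraction satisfies $E = tU + O(t^2)$ (\<open>retr_first_order\<close>). A metric
  projection is at least as close to $P + tU$ as any other feasible point, so one feasible curve
  within $O(t^2)$ of $P + tU$ is enough.
  The curve is $[R + H(t),\ tY]$, where $Y$ is the nonzero block of $U$: the affine constraints
  survive if $AH = 0$, and the diagonal constraints ask for an $H$ that compensates the defect
  $t^2\,\mathrm{diag}_B(YY^\top)$. LICQ supplies a linear right inverse of the differential of the
  diagonal constraints on $\{H : AH = 0\}$ (\<open>diag_constraints_right_inverse\<close>), and Brouwer's fixed
  point theorem absorbs the quadratic error, with $H = O(t^2)$ (\<open>feasible_curve\<close>).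
\<close>

section \<open>Projection onto a closed convex cone\<close>

lemma closed_dual_cone: "closed (dual_cone (K :: (real^'k^'k) set))"
proof -
  have eq: "dual_cone K = {X. transpose X = X} \<inter> (\<Inter>Y\<in>K. {X. inner X Y \<ge> 0})"
    by (auto simp: dual_cone_def)
  have "continuous_on UNIV (\<lambda>X::real^'k^'k. transpose X)"
    unfolding transpose_def by (intro continuous_intros continuous_on_vec_lambda)
  then have "closed {X::real^'k^'k. transpose X = X}"
    by (intro closed_Collect_eq) (auto intro: continuous_intros)
  moreover have "closed {X::real^'k^'k. inner X Y \<ge> 0}" for Y
    by (intro closed_Collect_le continuous_intros)
  ultimately show ?thesis
    unfolding eq by (intro closed_Int closed_INT) auto
qed

lemma convex_cone_dual_cone: "convex_cone (dual_cone (K :: (real^'k^'k) set))"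
  by (auto simp: convex_cone_iff dual_cone_def transpose_def vec_eq_iff inner_add_left)

text \<open>
  Half of Moreau's decomposition: the residual $x - \Pi x$ is orthogonal to $\Pi x$ and lies in the
  polar cone. The first part comes from testing the variational inequality with the two points
  $0$ and $2\,\Pi x$ of the ray through $\Pi x$.
\<close>

lemma closest_point_convex_cone:
  fixes C :: "'a::euclidean_space set"
  assumes "closed C" "convex_cone C"
  shows "inner x (closest_point C x) = (norm (closest_point C x))\<^sup>2"
    and "y \<in> C \<Longrightarrow> inner x y \<le> inner (closest_point C x) y"
proof -
  let ?p = "closest_point C x"
  have conv: "convex C" and con: "conic C" and ne: "C \<noteq> {}"
    using assms(2) by (auto simp: convex_cone_def)
  have p: "?p \<in> C"
    using closest_point_in_set assms(1) ne by blast
  have dot: "inner (x - ?p) (z - ?p) \<le> 0" if "z \<in> C" for z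
    using closest_point_dot[OF conv assms(1) that] .
  have "0 \<in> C" "2 *\<^sub>R ?p \<in> C"
    using conicD[OF con p, of 0] conicD[OF con p, of 2] by auto
  from dot[OF this(1)] dot[OF this(2)] have *: "inner (x - ?p) ?p = 0"
    by (simp add: algebra_simps scaleR_2)
  then show "inner x ?p = (norm ?p)\<^sup>2"
    by (simp add: inner_diff_left power2_norm_eq_inner)
  show "inner x y \<le> inner ?p y" if "y \<in> C"
    using dot[OF that] * by (simp add: inner_diff_left inner_diff_right)
qed

text \<open>
  By the preceding lemma $\frac12\|\Pi x\|^2$ is the maximum over $y \in C$ of
  $\langle x, y\rangle - \frac12\|y\|^2$, attained at $\Pi x$. Using the maximizer for $x$ at $x + d$
  gives the lower bound; using the maximizer for $x + d$ at $x$ gives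
  $\rho \le \langle d, \Pi(x+d) - \Pi x\rangle$, and the projection is nonexpansive.
\<close>

lemma half_norm_closest_point_cone_expansion:
  fixes C :: "'a::euclidean_space set" and x d :: 'a
  assumes "closed C" "convex_cone C"
  defines "\<rho> \<equiv> (norm (closest_point C (x + d)))\<^sup>2 / 2 - (norm (closest_point C x))\<^sup>2 / 2
                - inner (closest_point C x) d"
  shows "0 \<le> \<rho>" and "\<rho> \<le> (norm d)\<^sup>2"
proof -
  let ?p = "closest_point C x" and ?p' = "closest_point C (x + d)"
  have conv: "convex C" and ne: "C \<noteq> {}"
    using assms(2) by (auto simp: convex_cone_def)
  have in_C: "?p \<in> C" "?p' \<in> C"
    by (simp_all add: closest_point_in_set assms(1) ne)
  note proj = closest_point_convex_cone[OF assms(1,2)]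
  have sq: "0 \<le> (norm ?p)\<^sup>2 + (norm ?p')\<^sup>2 - 2 * inner ?p ?p'"
    using zero_le_power2[of "norm (?p - ?p')"]
    by (simp add: power2_norm_eq_inner inner_diff_left inner_diff_right inner_commute)
  have lo: "inner ?p ?p + inner d ?p \<le> inner ?p' ?p"
    using proj(2)[OF in_C(1), of "x + d"] proj(1)[of x]
    by (simp add: inner_add_left power2_norm_eq_inner)
  have up: "inner ?p' ?p' - inner d ?p' \<le> inner ?p ?p'"
    using proj(2)[OF in_C(2), of x] proj(1)[of "x + d"]
    by (simp add: inner_add_left power2_norm_eq_inner algebra_simps)
  show "0 \<le> \<rho>"
    using lo sq unfolding \<rho>_def by (simp add: power2_norm_eq_inner inner_commute)
  have "\<rho> \<le> inner d (?p' - ?p)"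
    using up sq unfolding \<rho>_def
    by (simp add: power2_norm_eq_inner inner_commute inner_diff_right)
  also have "\<dots> \<le> norm d * norm (?p' - ?p)"
    by (rule norm_cauchy_schwarz)
  also have "norm (?p' - ?p) \<le> norm d"
    using closest_point_lipschitz[OF conv assms(1) ne, of "x + d" x] by (simp add: dist_norm)
  finally show "\<rho> \<le> (norm d)\<^sup>2"
    by (simp add: power2_eq_square mult_left_mono)
qed

section \<open>Gram matrices, blocks and diagonal matrices\<close>

lemma inner_matrix_vector_transpose:
  fixes M :: "real^'n^'m"
  shows "inner x (M *v y) = inner (transpose M *v x) y"
  by (metis dot_lmul_matrix transpose_matrix_vector)

lemma inner_gram: "inner M (gram N Y) = (\<Sum>j<N. inner (Y j) (M *v Y j))"
proof -
  have "inner M (gram N Y) = (\<Sum>i\<in>UNIV. \<Sum>k\<in>UNIV. \<Sum>j<N. Y j $ i * (M $ i $ k * Y j $ k))"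
    by (simp add: gram_def inner_vec_def sum_distrib_left algebra_simps)
  also have "\<dots> = (\<Sum>i\<in>UNIV. \<Sum>j<N. \<Sum>k\<in>UNIV. Y j $ i * (M $ i $ k * Y j $ k))"
    by (intro sum.cong refl sum.swap)
  also have "\<dots> = (\<Sum>j<N. \<Sum>i\<in>UNIV. \<Sum>k\<in>UNIV. Y j $ i * (M $ i $ k * Y j $ k))"
    by (rule sum.swap)
  finally show ?thesis
    by (simp add: inner_vec_def matrix_vector_mult_def sum_distrib_left)
qed

lemma sum_UNIV_option:
  fixes g :: "'n::finite option \<Rightarrow> 'a::comm_monoid_add"
  shows "(\<Sum>k\<in>UNIV. g k) = g None + (\<Sum>i\<in>UNIV. g (Some i))"
  by (simp add: UNIV_option_conv sum.reindex)

text \<open>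
  The leading row $e_1^\top$ of $\widehat X$ meets only column \<open>0\<close>, so beyond the form of $M_{22}$ it
  contributes a constant and a term linear in that column.
\<close>

lemma inner_gram_hat:
  fixes M :: "real^('n::finite option)^('n option)"
  assumes "transpose M = M" "N \<ge> 1"
  shows "inner M (gram N (hat X)) =
    M $ None $ None + 2 * inner (block21 M) (X 0) + (\<Sum>j<N. inner (X j) (block22 M *v X j))"
proof -
  have sym: "M $ None $ Some i = M $ Some i $ None" for i
    using arg_cong[OF assms(1), of "\<lambda>X. X $ Some i $ None"] by (simp add: transpose_def)
  have "inner (hat X j) (M *v hat X j) =
      (if j = 0 then M $ None $ None + 2 * inner (block21 M) (X 0) else 0)
      + inner (X j) (block22 M *v X j)" for j
    by (cases "j = 0") (simp_all add: inner_vec_def matrix_vector_mult_def sum_UNIV_option hat_def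
        block21_def block22_def sym sum.distrib distrib_left sum_distrib_left mult.commute)
  then show ?thesis
    using assms(2) by (simp add: inner_gram sum.distrib)
qed

lemma diag_adj_mult: "diag_adj B \<mu> *v v = (\<chi> i. if i \<in> B then \<mu> i * v $ i else 0)"
proof -
  have "(\<Sum>k\<in>UNIV. (if i = k \<and> i \<in> B then \<mu> i else 0) * v $ k) = (if i \<in> B then \<mu> i * v $ i else 0)" for i
    by (simp add: if_distrib[of "\<lambda>x. x * _"] cong: if_cong)
  then show ?thesis
    by (simp add: diag_adj_def matrix_vector_mult_def)
qed

lemma transpose_diag_adj: "transpose (diag_adj B \<mu>) = diag_adj B \<mu>"
  by (auto simp: diag_adj_def transpose_def vec_eq_iff)

lemma inner_diag_adj: "inner (diag_adj B \<mu>) G = (\<Sum>i\<in>B. \<mu> i * G $ i $ i)"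
proof -
  have "(\<Sum>k\<in>UNIV. diag_adj B \<mu> $ i $ k * G $ i $ k) = (if i \<in> B then \<mu> i * G $ i $ i else 0)" for i
    by (cases "i \<in> B") (simp_all add: diag_adj_def if_distrib[of "\<lambda>x. x * _"] cong: if_cong)
  then have "inner (diag_adj B \<mu>) G = (\<Sum>i\<in>UNIV. if i \<in> B then \<mu> i * G $ i $ i else 0)"
    by (simp add: inner_vec_def)
  then show ?thesis
    by (simp add: sum.If_cases)
qed

section \<open>The orthogonal projector onto the kernel of a matrix of full row rank\<close>

lemma matrix_mul_diff_distrib:
  fixes X :: "real^'n^'m" and Y Z :: "real^'k^'n"
  shows "X ** (Y - Z) = X ** Y - X ** Z"
  by (simp add: matrix_eq matrix_vector_mult_diff_rdistrib matrix_vector_mult_diff_distrib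
      flip: matrix_vector_mul_assoc)

lemma matrix_mul_diff_rdistrib:
  fixes X Y :: "real^'n^'m" and Z :: "real^'k^'n"
  shows "(X - Y) ** Z = X ** Z - Y ** Z"
  by (simp add: matrix_eq matrix_vector_mult_diff_rdistrib flip: matrix_vector_mul_assoc)

lemma null_proj_properties:
  fixes A :: "real^'n^'m"
  assumes "rank A = CARD('m)"
  shows "A ** null_proj A = 0" and "transpose (null_proj A) = null_proj A"
    and "null_proj A ** null_proj A = null_proj A"
proof -
  have inj: "inj ((*v) (transpose A))"
    using assms by (metis full_rank_injective rank_transpose)
  have "x = 0" if "(A ** transpose A) *v x = 0" for x
  proof -
    have "inner (transpose A *v x) (transpose A *v x) = inner x ((A ** transpose A) *v x)"
      by (simp add: inner_matrix_vector_transpose matrix_vector_mul_assoc[symmetric])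
    then have "transpose A *v x = transpose A *v 0"
      using that by simp
    with inj show ?thesis by (rule injD)
  qed
  then have "invertible (A ** transpose A)"
    by (metis invertible_left_inverse matrix_left_invertible_ker)
  then have "\<exists>G. (A ** transpose A) ** G = mat 1 \<and> G ** (A ** transpose A) = mat 1"
    by (simp add: invertible_def)
  from someI_ex[OF this]
  have G: "(A ** transpose A) ** matrix_inv (A ** transpose A) = mat 1"
    unfolding matrix_inv_def by simp
  let ?G = "matrix_inv (A ** transpose A)"
  have "transpose ?G ** (A ** transpose A) = mat 1"
    using arg_cong[OF G, of transpose] by (simp add: matrix_transpose_mul)
  then have Gsym: "transpose ?G = ?G"
    by (metis G matrix_mul_assoc matrix_mul_lid matrix_mul_rid)
  show AJ: "A ** null_proj A = 0"
    by (simp add: null_proj_def pinv_def matrix_mul_diff_distrib matrix_mul_assoc G)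
  have "transpose (pinv A ** A) = pinv A ** A"
    by (simp add: pinv_def matrix_transpose_mul Gsym matrix_mul_assoc)
  moreover have "transpose (X - Y) = transpose X - transpose Y" for X Y :: "real^'n^'n"
    by (simp add: transpose_def vec_eq_iff)
  ultimately show "transpose (null_proj A) = null_proj A"
    by (simp add: null_proj_def)
  have "null_proj A ** null_proj A = null_proj A - pinv A ** (A ** null_proj A)"
    by (subst null_proj_def) (simp add: matrix_mul_diff_rdistrib matrix_mul_assoc)
  then show "null_proj A ** null_proj A = null_proj A"
    by (simp add: AJ)
qed

section \<open>The differential of the diagonal constraints under LICQ\<close>

lemma gradient_constr_affine:
  "gradient r (constr A b r (Inl (k, l))) R j = (if j = l \<and> j < r then A $ k else 0)"
proof -
  have "(A *v (R j + t *\<^sub>R axis i 1)) $ k = (A *v R j) $ k + t * A $ k $ i" for t i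
    by (simp add: matrix_vector_right_distrib matrix_vector_mult_scaleR matrix_vector_mult_basis
        column_def)
  then have deriv: "deriv (\<lambda>t. constr A b r (Inl (k, l)) (R(j := R j + t *\<^sub>R axis i 1))) 0
      = (if j = l then A $ k $ i else 0)" for i
    by (auto intro!: DERIV_imp_deriv derivative_eq_intros simp: constr_def)
  then show ?thesis
    by (cases "j = l") (use deriv in \<open>simp_all add: gradient_def vec_eq_iff\<close>)
qed

lemma gradient_constr_diag:
  assumes "j < r"
  shows "gradient r (constr A b r (Inr i)) R j = (2 * R j $ i - of_bool (j = 0)) *\<^sub>R axis i 1"
proof -
  have gram: "gram r (R(j := R j + t *\<^sub>R axis k 1)) $ i $ i
      = (\<Sum>l\<in>{..<r}-{j}. R l $ i * R l $ i) + (R j $ i + t * of_bool (i = k))\<^sup>2" for t k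
    using assms by (simp add: gram_def sum.remove[of "{..<r}" j] axis_def power2_eq_square)
  have "deriv (\<lambda>t. constr A b r (Inr i) (R(j := R j + t *\<^sub>R axis k 1))) 0
      = (2 * R j $ i - of_bool (j = 0)) * of_bool (i = k)" for k
    unfolding constr_def sum.case gram
    by (rule DERIV_imp_deriv)
      (auto intro!: derivative_eq_intros simp: axis_def of_bool_def)
  then show ?thesis
    using assms by (auto simp: gradient_def vec_eq_iff axis_def)
qed

text \<open>
  LICQ restricted to the diagonal constraints on the subspace $AH = 0$. With
  $d_j = 2R_j - \delta_{j0}e$, column $j$ of $\sum_{i\in B} v_i\nabla g_i$, where $g_i$ is the
  diagonal constraint at $i$, is $\mathrm{diag}_B(d_j)v$; if the
  projector onto $\ker A$ annihilates it, it equals $A^\top y_j$ for some $y_j$, that is, a combination of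
  gradients of the affine constraints. This is a linear dependence in which the gradients of the diagonal
  constraints have the coefficients \<open>v $ i\<close>.
\<close>

lemma LICQ_imp_projected_diag_injective:
  fixes A :: "real^'n^'m" and v :: "real^'n"
  assumes licq: "LICQ A b B r R"
    and ker: "\<forall>j<r. null_proj A *v (diag_adj B (\<lambda>i. 2 * R j $ i - of_bool (j = 0)) *v v) = 0"
    and "i \<in> B"
  shows "v $ i = 0"
proof -
  define w where "w j = diag_adj B (\<lambda>i. 2 * R j $ i - of_bool (j = 0)) *v v" for j
  define y where "y j = matrix_inv (A ** transpose A) *v (A *v w j)" for j
  have w: "w j = transpose A *v y j" if "j < r" for j
    using ker that unfolding w_def[symmetric] y_def
    by (simp add: null_proj_def pinv_def matrix_vector_mult_diff_rdistrib
        flip: matrix_vector_mul_assoc)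
  define a where "a s = (case s of Inl (k, j) \<Rightarrow> - y j $ k | Inr i \<Rightarrow> v $ i)" for s
  have "(\<Sum>s\<in>constr_index B r. a s *\<^sub>R gradient r (constr A b r s) R j) = 0" for j
  proof (cases "j < r")
    case False
    then show ?thesis by (simp add: gradient_def vec_eq_iff)
  next
    case True
    have "(\<Sum>s\<in>UNIV \<times> {..<r}. a (Inl s) *\<^sub>R gradient r (constr A b r (Inl s)) R j)
        = (\<Sum>k\<in>UNIV. \<Sum>l<r. a (Inl (k, l)) *\<^sub>R gradient r (constr A b r (Inl (k, l))) R j)"
      by (simp add: sum.cartesian_product)
    also have "\<dots> = (\<Sum>k\<in>UNIV. \<Sum>l<r. if l = j then - y j $ k *\<^sub>R A $ k else 0)"
      using True by (intro sum.cong refl) (auto simp: a_def gradient_constr_affine)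
    also have "\<dots> = (\<Sum>k\<in>UNIV. - y j $ k *\<^sub>R A $ k)"
      using True by simp
    also have "\<dots> = - w j"
      using w[OF True]
      by (simp add: vec_eq_iff vector_matrix_mult_def sum_negf mult.commute)
    finally have 1: "(\<Sum>s\<in>UNIV \<times> {..<r}. a (Inl s) *\<^sub>R gradient r (constr A b r (Inl s)) R j)
        = - w j" .
    have "(\<Sum>i\<in>B. a (Inr i) *\<^sub>R gradient r (constr A b r (Inr i)) R j) $ k = w j $ k" for k
    proof -
      have "(\<Sum>i\<in>B. a (Inr i) *\<^sub>R gradient r (constr A b r (Inr i)) R j) $ k
          = (\<Sum>i\<in>B. if k = i then (2 * R j $ i - of_bool (j = 0)) * v $ i else 0)"
        unfolding sum_component using True
        by (intro sum.cong refl) (simp add: a_def gradient_constr_diag axis_def)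
      then show ?thesis
        by (simp add: w_def diag_adj_mult)
    qed
    then have 2: "(\<Sum>i\<in>B. a (Inr i) *\<^sub>R gradient r (constr A b r (Inr i)) R j) = w j"
      by (simp add: vec_eq_iff)
    show ?thesis
      unfolding constr_index_def by (simp add: sum.Plus 1 2)
  qed
  then have "\<forall>s\<in>constr_index B r. a s = 0"
    using licq unfolding LICQ_def by blast
  then show ?thesis
    using \<open>i \<in> B\<close> by (force simp: constr_index_def a_def)
qed

text \<open>
  The map $H \mapsto (\sum_j (d_j)_i H_{ij})_{i\in B}$ on $\{H : AH = 0\}$ composed with its adjoint is
  $v \mapsto \sum_j D_j J D_j v$ with $D_j = \mathrm{diag}_B(d_j)$ and $J$ the projector onto $\ker A$.
  Its quadratic form is $\sum_j \|J D_j v\|^2$, which is positive definite on $\mathbb{R}^B$ by the preceding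
  lemma. Adding the identity on the coordinates outside \<open>B\<close> makes it invertible on the whole space, with
  inverse $N$, and this inverse followed by the adjoint, $T_j = J D_j N$, is the right inverse.
\<close>

lemma diag_constraints_right_inverse:
  fixes A :: "real^'n^'m"
  assumes rank: "rank A = CARD('m)" and licq: "LICQ A b B r R"
  obtains T :: "nat \<Rightarrow> real^'n^'n"
  where "\<And>j a. A *v (T j *v a) = 0"
    and "\<And>i a. i \<in> B \<Longrightarrow>
      (\<Sum>j<r. (2 * R j $ i - of_bool (j = 0)) * (T j *v a) $ i) = a $ i"
proof -
  let ?J = "null_proj A"
  note J = null_proj_properties[OF rank]
  define D where "D j = diag_adj B (\<lambda>i. 2 * R j $ i - of_bool (j = 0))" for j
  define M where "M v = (\<Sum>j<r. D j *v (?J *v (D j *v v))) + diag_adj (- B) (\<lambda>_. 1) *v v" for v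
  have M_B: "M v $ i = (\<Sum>j<r. (D j *v (?J *v (D j *v v))) $ i)" if "i \<in> B" for v i
    using that by (simp add: M_def diag_adj_mult)
  have M_nB: "M v $ i = v $ i" if "i \<notin> B" for v i
    using that by (simp add: M_def D_def diag_adj_mult)
  have lin: "linear M"
    unfolding M_def by (intro linear_compose_add linear_compose_sum) (auto intro!: linearI
      simp: matrix_vector_right_distrib matrix_vector_mult_scaleR sum.distrib scaleR_sum_right)
  have ker: "v = 0" if "M v = 0" for v
  proof -
    have off: "v $ i = 0" if "i \<notin> B" for i
      using M_nB[OF that, of v] \<open>M v = 0\<close> by simp
    have "0 = inner v (M v)"
      using that by simp
    also have "\<dots> = (\<Sum>j<r. inner v (D j *v (?J *v (D j *v v))))
        + inner v (diag_adj (- B) (\<lambda>_. 1) *v v)"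
      by (simp add: M_def inner_add_right inner_sum_right)
    also have "inner v (diag_adj (- B) (\<lambda>_. 1) *v v) = 0"
      by (auto simp: inner_vec_def diag_adj_mult off intro!: sum.neutral)
    also have "(\<Sum>j<r. inner v (D j *v (?J *v (D j *v v))))
        = (\<Sum>j<r. (norm (?J *v (D j *v v)))\<^sup>2)"
    proof (intro sum.cong refl)
      fix j
      have "inner v (D j *v (?J *v (D j *v v))) = inner (D j *v v) (?J *v (D j *v v))"
        by (metis D_def inner_matrix_vector_transpose transpose_diag_adj)
      also have "\<dots> = inner (D j *v v) (?J *v (?J *v (D j *v v)))"
        by (metis matrix_vector_mul_assoc J(3))
      also have "\<dots> = inner (?J *v (D j *v v)) (?J *v (D j *v v))"
        by (metis inner_matrix_vector_transpose J(2))
      finally show "inner v (D j *v (?J *v (D j *v v))) = (norm (?J *v (D j *v v)))\<^sup>2"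
        by (simp add: power2_norm_eq_inner)
    qed
    finally have "\<forall>j<r. ?J *v (D j *v v) = 0"
      by (simp add: sum_nonneg_eq_0_iff)
    then have "v $ i = 0" if "i \<in> B" for i
      using LICQ_imp_projected_diag_injective[OF licq _ that, of v] by (simp add: D_def)
    with off show "v = 0"
      by (metis vec_eq_iff zero_index)
  qed
  then have "inj M"
    using lin by (simp add: linear_injective_0)
  then obtain N where N: "linear N" "\<And>x. M (N x) = x"
    using linear_injective_isomorphism[OF lin] by blast
  define T where "T j = ?J ** D j ** matrix N" for j
  have T: "T j *v a = ?J *v (D j *v N a)" for j a
    using N(1) by (simp add: T_def matrix_works flip: matrix_vector_mul_assoc)
  show ?thesis
  proof
    show "A *v (T j *v a) = 0" for j a
      unfolding T by (metis J(1) matrix_vector_mul_assoc matrix_vector_mult_0)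
    show "(\<Sum>j<r. (2 * R j $ i - of_bool (j = 0)) * (T j *v a) $ i) = a $ i" if "i \<in> B" for i a
      using M_B[OF that, of "N a"] that unfolding N(2) T
      by (subst (asm) D_def) (simp add: diag_adj_mult)
  qed
qed

section \<open>Feasible curves with prescribed velocity\<close>

lemma sum_hcat: "(\<Sum>j<r + s. g (hcat r X Y j)) = (\<Sum>j<r. g (X j)) + (\<Sum>j<s. g (Y j))"
  by (induction s) (simp_all add: hcat_def add.assoc)

lemma gram_hcat: "gram (r + s) (hcat r X Y) = gram r X + gram s Y"
  by (simp add: gram_def vec_eq_iff sum_hcat[where g = "\<lambda>v. v $ _ * v $ _"])

text \<open>
  For $X = [R + Ta,\ tY]$ the diagonal constraints read $a + q(a) + t^2 y = 0$ on \<open>B\<close>, where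
  $q$ is the diagonal of the Gram matrix of $Ta$ and $y$ that of $YY^\top$. Since $q$ is quadratic,
  $a \mapsto -t^2 y - q(a)$ maps the ball of radius $2\eta t^2$, with $\eta = \|y\|$, into itself once
  \<open>t\<close> is small, so Brouwer's theorem gives a solution of size $O(t^2)$.
\<close>

lemma feasible_curve:
  fixes A :: "real^'n^'m"
  assumes rank: "rank A = CARD('m)" and licq: "LICQ A b B r R"
    and R: "R \<in> feasible A b B r" and r: "r \<ge> 1"
    and Y: "Y \<in> mats s" "\<And>j. A *v Y j = 0"
  obtains \<kappa> where "\<forall>\<^sub>F t in at 0. \<exists>X\<in>feasible A b B (r + s).
    \<forall>j. norm (X j - hcat r R (\<lambda>j. t *\<^sub>R Y j) j) \<le> \<kappa> * t\<^sup>2"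
proof -
  obtain T :: "nat \<Rightarrow> real^'n^'n" where AT: "\<And>j a. A *v (T j *v a) = 0"
    and T: "\<And>i a. i \<in> B \<Longrightarrow>
      (\<Sum>j<r. (2 * R j $ i - of_bool (j = 0)) * (T j *v a) $ i) = a $ i"
    using diag_constraints_right_inverse[OF rank licq] by blast
  define y :: "real^'n" where "y = (\<chi> i. gram s Y $ i $ i)"
  define q :: "real^'n \<Rightarrow> real^'n" where "q a = (\<chi> i. \<Sum>j<r. ((T j *v a) $ i)\<^sup>2)" for a
  define k where "k = (\<Sum>j<r. onorm ((*v) (T j)))"
  have onorm_nonneg: "0 \<le> onorm ((*v) (T j))" for j
    by (simp add: onorm_pos_le matrix_vector_mul_bounded_linear)
  have T_bound: "norm (T j *v a) \<le> k * norm a" if "j < r" for j a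
  proof -
    have "norm (T j *v a) \<le> onorm ((*v) (T j)) * norm a"
      by (simp add: onorm matrix_vector_mul_bounded_linear)
    also have "onorm ((*v) (T j)) \<le> k"
      unfolding k_def using that onorm_nonneg by (intro member_le_sum) auto
    finally show ?thesis by (simp add: mult_right_mono)
  qed
  have k_nonneg: "k \<ge> 0"
    unfolding k_def by (intro sum_nonneg onorm_nonneg)
  define C where "C = CARD('n) * r * k\<^sup>2"
  have q_bound: "norm (q a) \<le> C * (norm a)\<^sup>2" for a
  proof -
    have "norm (q a) \<le> (\<Sum>i\<in>UNIV. \<bar>q a $ i\<bar>)"
      by (rule norm_le_l1_cart)
    also have "\<dots> \<le> (\<Sum>i\<in>(UNIV :: 'n set). \<Sum>j<r. (k * norm a)\<^sup>2)"
    proof (intro sum_mono)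
      fix i
      have "((T j *v a) $ i)\<^sup>2 \<le> (k * norm a)\<^sup>2" if "j < r" for j
        using order_trans[OF component_le_norm_cart T_bound[OF that]]
        by (metis abs_ge_zero power2_abs power_mono)
      then have "(\<Sum>j<r. ((T j *v a) $ i)\<^sup>2) \<le> (\<Sum>j<r. (k * norm a)\<^sup>2)"
        by (intro sum_mono) simp
      then show "\<bar>q a $ i\<bar> \<le> (\<Sum>j<r. (k * norm a)\<^sup>2)"
        by (simp add: q_def sum_nonneg)
    qed
    finally show ?thesis
      by (simp add: C_def power_mult_distrib mult.assoc)
  qed
  have C_nonneg: "C \<ge> 0"
    by (simp add: C_def)
  define \<eta> where "\<eta> = norm y"
  have \<eta>: "\<eta> \<ge> 0" "norm y \<le> \<eta>"
    by (simp_all add: \<eta>_def)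
  have "\<exists>X\<in>feasible A b B (r + s).
      \<forall>j. norm (X j - hcat r R (\<lambda>j. t *\<^sub>R Y j) j) \<le> (2 * k * \<eta>) * t\<^sup>2"
    if t: "4 * C * \<eta> * t\<^sup>2 < 1" for t
  proof -
    define \<rho> where "\<rho> = 2 * \<eta> * t\<^sup>2"
    define \<phi> where "\<phi> a = - (t\<^sup>2 *\<^sub>R y) - q a" for a
    have "\<rho> \<ge> 0"
      using \<eta> by (simp add: \<rho>_def)
    have "continuous_on (cball 0 \<rho>) \<phi>"
      unfolding \<phi>_def q_def by (intro continuous_intros continuous_on_vec_lambda
          linear_continuous_on matrix_vector_mul_bounded_linear)
    moreover have "\<phi> a \<in> cball 0 \<rho>" if "a \<in> cball 0 \<rho>" for a
    proof -
      have "norm (\<phi> a) \<le> t\<^sup>2 * norm y + norm (q a)"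
        unfolding \<phi>_def using norm_triangle_ineq4[of "- (t\<^sup>2 *\<^sub>R y)" "q a"] by simp
      also have "norm (q a) \<le> C * \<rho>\<^sup>2"
        using that C_nonneg
        by (intro order_trans[OF q_bound] mult_left_mono power_mono) simp_all
      also have "C * \<rho>\<^sup>2 = (\<eta> * t\<^sup>2) * (4 * C * \<eta> * t\<^sup>2)"
        by (simp add: \<rho>_def power2_eq_square)
      also have "\<dots> \<le> (\<eta> * t\<^sup>2) * 1"
        using t \<eta> by (intro mult_left_mono) simp_all
      also have "t\<^sup>2 * norm y \<le> \<eta> * t\<^sup>2"
        using \<eta>(2) by (simp add: mult.commute mult_right_mono)
      finally show ?thesis
        by (simp add: \<rho>_def)
    qed
    ultimately obtain a where a: "norm a \<le> \<rho>" "\<phi> a = a"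
      using brouwer[of "cball 0 \<rho>" \<phi>] \<open>\<rho> \<ge> 0\<close> by (auto simp: Pi_iff)
    define X where "X = hcat r (\<lambda>j. R j + T j *v a) (\<lambda>j. t *\<^sub>R Y j)"
    have "gram (r + s) X $ i $ i = X 0 $ i" if "i \<in> B" for i
    proof -
      have "gram r (\<lambda>j. R j + T j *v a) $ i $ i
          = gram r R $ i $ i + (\<Sum>j<r. 2 * R j $ i * (T j *v a) $ i) + q a $ i"
        by (simp add: gram_def q_def power2_eq_square algebra_simps flip: sum.distrib)
      also have "gram r R $ i $ i = R 0 $ i"
        using R that by (simp add: feasible_def)
      also have "(\<Sum>j<r. 2 * R j $ i * (T j *v a) $ i) = a $ i + (T 0 *v a) $ i"
        using T[OF that, of a] r
        by (simp add: left_diff_distrib sum_subtractf of_bool_def if_distrib[of "\<lambda>x. x * _"]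
            cong: if_cong)
      also have "a $ i = - (t\<^sup>2 * y $ i) - q a $ i"
        using a(2) by (simp add: \<phi>_def vec_eq_iff)
      also have "t\<^sup>2 * y $ i = gram s (\<lambda>j. t *\<^sub>R Y j) $ i $ i"
        by (simp add: y_def gram_def sum_distrib_left power2_eq_square mult_ac)
      finally show ?thesis
        using r by (simp add: X_def gram_hcat) (simp add: hcat_def)
    qed
    moreover have "A *v X j = (if j = 0 then b else 0)" for j
      using R r Y(2) AT
      by (auto simp: X_def hcat_def feasible_def matrix_vector_right_distrib
          matrix_vector_mult_scaleR)
    moreover have "X \<in> mats (r + s)"
      using Y(1) by (auto simp: mats_def X_def hcat_def)
    ultimately have "X \<in> feasible A b B (r + s)"
      by (simp add: feasible_def)
    moreover have "norm (X j - hcat r R (\<lambda>j. t *\<^sub>R Y j) j) \<le> (2 * k * \<eta>) * t\<^sup>2" for j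
    proof (cases "j < r")
      case True
      then have "norm (X j - hcat r R (\<lambda>j. t *\<^sub>R Y j) j) \<le> k * norm a"
        by (simp add: X_def hcat_def T_bound)
      also have "\<dots> \<le> k * \<rho>"
        using a(1) k_nonneg by (rule mult_left_mono)
      finally show ?thesis
        by (simp add: \<rho>_def mult_ac)
    next
      case False
      then show ?thesis
        using k_nonneg \<eta> by (simp add: X_def hcat_def)
    qed
    ultimately show ?thesis by blast
  qed
  moreover have "\<forall>\<^sub>F t in at 0. 4 * C * \<eta> * t\<^sup>2 < 1"
  proof (rule order_tendstoD(2))
    show "((\<lambda>t. 4 * C * \<eta> * t\<^sup>2) \<longlongrightarrow> 0) (at 0)"
      by (auto intro!: tendsto_eq_intros)
  qed simp
  ultimately have "\<forall>\<^sub>F t in at 0. \<exists>X\<in>feasible A b B (r + s).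
    \<forall>j. norm (X j - hcat r R (\<lambda>j. t *\<^sub>R Y j) j) \<le> (2 * k * \<eta>) * t\<^sup>2"
    by (rule eventually_mono[rotated])
  then show ?thesis by (rule that)
qed

section \<open>Metric projection onto the feasible set\<close>

lemma closed_feasible: "closed (feasible A b B N)"
proof -
  have "feasible A b B N = (\<Inter>j\<in>{N..}. {X. X j = 0})
      \<inter> (\<Inter>j\<in>{..<N}. {X. A *v X j = (if j = 0 then b else 0)})
      \<inter> (\<Inter>i\<in>B. {X. (\<Sum>j<N. X j $ i * X j $ i) = X 0 $ i})"
    by (auto simp: feasible_def mats_def gram_def)
  also have "closed \<dots>"
    by (intro closed_Int closed_INT ballI closed_Collect_eq continuous_intros
        continuous_on_product_coordinates matrix_vector_mul_bounded_linear
        bounded_linear.continuous_on[OF matrix_vector_mul_bounded_linear])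
  finally show ?thesis .
qed

text \<open>
  Sequences of columns carry the product topology. A minimizer may be sought among the matrices at
  least as close to \<open>Z\<close> as a given \<open>X0\<close>; these lie in a product of balls, with
  \<open>{0}\<close> from column \<open>N\<close> on, which is compact by Tychonoff's theorem.
\<close>

lemma frob_dist_attains_min:
  fixes M :: "(nat \<Rightarrow> real^'n) set"
  assumes "closed M" "M \<noteq> {}" "M \<subseteq> mats N"
  shows "\<exists>X\<in>M. \<forall>Y\<in>M. frob_dist N X Z \<le> frob_dist N Y Z"
proof -
  obtain X0 where X0: "X0 \<in> M"
    using assms(2) by blast
  define box where "box = (\<lambda>j. if j < N then cball (Z j) (frob_dist N X0 Z) else {0})"
  have in_box: "Y \<in> PiE UNIV box"
    if "Y \<in> M" "frob_dist N Y Z \<le> frob_dist N X0 Z" for Y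
  proof -
    have "dist (Z j) (Y j) \<le> frob_dist N X0 Z" if "j < N" for j
      using member_le_L2_set[of "{..<N}" j "\<lambda>j. dist (Y j) (Z j)"] that
        \<open>frob_dist N Y Z \<le> frob_dist N X0 Z\<close>
      by (simp add: frob_dist_def dist_commute)
    moreover have "Y j = 0" if "\<not> j < N" for j
      using assms(3) \<open>Y \<in> M\<close> that by (auto simp: mats_def)
    ultimately show ?thesis
      by (auto simp: box_def)
  qed
  have "compactin (product_topology (\<lambda>_. euclidean) UNIV) (PiE UNIV box)"
    by (auto simp: compactin_PiE box_def)
  then have "compact (PiE UNIV box)"
    by (simp add: euclidean_product_topology)
  then have "compact (PiE UNIV box \<inter> M)"
    using assms(1) by (rule compact_Int_closed)
  moreover have "PiE UNIV box \<inter> M \<noteq> {}"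
    using in_box[OF X0] X0 by blast
  moreover have "continuous_on (PiE UNIV box \<inter> M) (\<lambda>X. frob_dist N X Z)"
    unfolding frob_dist_def L2_set_def
    by (intro continuous_intros continuous_on_subset[OF continuous_on_product_coordinates subset_UNIV])
  ultimately obtain X where X: "X \<in> M" "X \<in> PiE UNIV box"
    and min: "\<And>Y. Y \<in> PiE UNIV box \<Longrightarrow> Y \<in> M \<Longrightarrow> frob_dist N X Z \<le> frob_dist N Y Z"
    using continuous_attains_inf[of "PiE UNIV box \<inter> M" "\<lambda>X. frob_dist N X Z"] by auto
  have "frob_dist N X Z \<le> frob_dist N Y Z" if "Y \<in> M" for Y
    using min[OF in_box[OF that] that] min[OF in_box[OF X0] X0] by fastforce
  with X(1) show ?thesis by blast
qed

lemma retr_feasible: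
  fixes A :: "real^'n^'m"
  assumes "feasible A b B N \<noteq> {}"
  shows "retr N (feasible A b B N) P H \<in> feasible A b B N"
    and "Y \<in> feasible A b B N \<Longrightarrow>
      frob_dist N (retr N (feasible A b B N) P H) (\<lambda>j. P j + H j) \<le> frob_dist N Y (\<lambda>j. P j + H j)"
proof -
  let ?f = "\<lambda>X. frob_dist N X (\<lambda>j. P j + H j)" and ?M = "feasible A b B N"
  have "\<exists>X. is_arg_min ?f (\<lambda>X. X \<in> ?M) X"
    using frob_dist_attains_min[OF closed_feasible assms, of N "\<lambda>j. P j + H j"]
    by (auto simp: is_arg_min_linorder feasible_def)
  from someI_ex[OF this]
  have "is_arg_min ?f (\<lambda>X. X \<in> ?M) (retr N ?M P H)"
    unfolding retr_def arg_min_on_def arg_min_def .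
  then show "retr N ?M P H \<in> ?M" and "Y \<in> ?M \<Longrightarrow> ?f (retr N ?M P H) \<le> ?f Y"
    by (auto simp: is_arg_min_linorder)
qed

text \<open>
  A nearest feasible point to $P + tU$ is at most as far away as the curve of \<open>feasible_curve\<close>,
  hence within $O(t^2)$.
\<close>

lemma retr_first_order:
  fixes A :: "real^'n^'m"
  assumes rank: "rank A = CARD('m)" and licq: "LICQ A b B r R"
    and R: "R \<in> feasible A b B r" and r: "r \<ge> 1"
    and Y: "Y \<in> mats s" "\<And>j. A *v Y j = 0"
  defines "P \<equiv> hcat r R (\<lambda>j. 0)" and "U \<equiv> hcat r (\<lambda>j. 0) Y"
  assumes j: "j < r + s"
  shows "(\<lambda>t. (retr (r + s) (feasible A b B (r + s)) P (\<lambda>j. t *\<^sub>R U j) j $ i - P j $ i) - t * U j $ i)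
    \<in> O[at 0](\<lambda>t. t\<^sup>2)"
proof -
  let ?F = "feasible A b B (r + s)" and ?Z = "\<lambda>t j. P j + t *\<^sub>R U j"
  obtain \<kappa> where \<kappa>: "\<forall>\<^sub>F t in at 0. \<exists>X\<in>?F.
    \<forall>j. norm (X j - hcat r R (\<lambda>j. t *\<^sub>R Y j) j) \<le> \<kappa> * t\<^sup>2"
    using feasible_curve[OF rank licq R r Y] by blast
  have Z: "hcat r R (\<lambda>j. t *\<^sub>R Y j) j = ?Z t j" for t j
    by (simp add: P_def U_def hcat_def)
  show ?thesis
  proof (rule bigoI[where c = "real (r + s) * \<kappa>"], use \<kappa> in eventually_elim)
    case (elim t)
    then obtain X where X: "X \<in> ?F" "\<And>j. norm (X j - ?Z t j) \<le> \<kappa> * t\<^sup>2"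
      unfolding Z by blast
    let ?X = "retr (r + s) ?F P (\<lambda>j. t *\<^sub>R U j)"
    have "\<bar>(?X j $ i - P j $ i) - t * U j $ i\<bar> = \<bar>(?X j - ?Z t j) $ i\<bar>"
      by simp
    also have "\<dots> \<le> dist (?X j) (?Z t j)"
      unfolding dist_norm by (rule component_le_norm_cart)
    also have "\<dots> \<le> frob_dist (r + s) ?X (?Z t)"
      unfolding frob_dist_def using j by (intro member_le_L2_set) auto
    also have "\<dots> \<le> frob_dist (r + s) X (?Z t)"
      using X(1) by (intro retr_feasible(2)) auto
    also have "\<dots> \<le> (\<Sum>j<r + s. dist (X j) (?Z t j))"
      unfolding frob_dist_def by (rule L2_set_le_sum) simp
    also have "\<dots> \<le> (\<Sum>j<r + s. \<kappa> * t\<^sup>2)"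
      using X(2) by (intro sum_mono) (simp add: dist_norm)
    finally show ?case
      by (simp add: mult.assoc)
  qed
qed

section \<open>Expansion of the objective at a KKT point\<close>

lemma symmetric_quadratic_diff:
  fixes M :: "real^'n^'n"
  assumes "transpose M = M"
  shows "inner x (M *v x) - inner p (M *v p) = inner (x - p) (M *v (x - p)) + 2 * inner (x - p) (M *v p)"
proof -
  have "inner p (M *v x) = inner x (M *v p)"
    by (metis assms inner_commute inner_matrix_vector_transpose)
  then show ?thesis
    by (simp add: matrix_vector_mult_diff_distrib inner_diff_left inner_diff_right)
qed

lemma transpose_cost_mat: "transpose Q = Q \<Longrightarrow> transpose (cost_mat Q c) = cost_mat Q c"
  by (auto simp: transpose_def cost_mat_def vec_eq_iff split: option.split)

text \<open>
  Let $E = X - P$. With $D = \mathrm{diag}_B^*(\mu)$ the relevant blocks are $(C - W)_{22} = L + D$ and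
  $(C - W)_{21} = c - W_{21}$. Expanding the quadratic form of $L$ around $P$, stationarity evaluates the
  linear term as $-\langle q, E_0\rangle$, because $AE = 0$ removes $A^\top\lambda$. The diagonal
  constraints hold at both points, so the form of $D$ changes by $\langle De, E_0\rangle$.
  By the definition of $q$ all terms linear in $E_0$ cancel.
\<close>

lemma objective_linear_part_KKT:
  fixes Q L :: "real^'n^'n" and A :: "real^'n^'m"
  assumes sym: "transpose Q = Q" "transpose W = W"
    and L: "L = Q - diag_adj B \<mu> - block22 W"
    and q: "q = 2 *\<^sub>R c + diag_adj B \<mu> *v 1 - 2 *\<^sub>R block21 W"
    and KKT: "\<And>j. j < N \<Longrightarrow> 2 *\<^sub>R (L *v P j) + (if j = 0 then q else 0) - transpose A *v lam j = 0"
    and P: "P \<in> feasible A b B N" and X: "X \<in> feasible A b B N" and N: "N \<ge> 1"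
  shows "inner (cost_mat Q c - W) (gram N (hat X) - gram N (hat P))
    = (\<Sum>j<N. inner (X j - P j) (L *v (X j - P j)))"
proof -
  let ?M = "cost_mat Q c - W" and ?D = "diag_adj B \<mu>" and ?E = "\<lambda>j. X j - P j"
  have b21: "block21 ?M = c - block21 W"
    by (simp add: block21_def cost_mat_def vec_eq_iff)
  have b22: "block22 ?M = L + ?D"
    by (simp add: L block22_def cost_mat_def vec_eq_iff)
  have Msym: "transpose ?M = ?M"
    using transpose_cost_mat[OF sym(1), of c] sym(2)
    by (simp add: transpose_def vec_eq_iff)
  have "transpose (block22 ?M) = block22 ?M"
    using Msym by (simp add: transpose_def block22_def vec_eq_iff)
  then have Lsym: "transpose L = L"
    unfolding b22 using transpose_diag_adj[of B \<mu>] by (simp add: transpose_def vec_eq_iff)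
  have lin: "2 * inner (?E j) (L *v P j) = (if j = 0 then - inner (?E j) q else 0)" if "j < N" for j
  proof -
    have "A *v ?E j = 0"
      using P X that by (simp add: feasible_def matrix_vector_mult_diff_distrib)
    then have "inner (?E j) (transpose A *v lam j) = 0"
      by (metis inner_matrix_vector_transpose inner_zero_left transpose_transpose)
    moreover have "2 *\<^sub>R (L *v P j) = transpose A *v lam j - (if j = 0 then q else 0)"
      using KKT[OF that] by (simp add: algebra_simps)
    then have "inner (?E j) (2 *\<^sub>R (L *v P j)) =
        inner (?E j) (transpose A *v lam j) - inner (?E j) (if j = 0 then q else 0)"
      by (metis inner_diff_right)
    ultimately show ?thesis by auto
  qed
  have diag: "inner ?D (gram N Y) = inner (Y 0) (?D *v 1)" if "Y \<in> feasible A b B N" for Y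
  proof -
    have "inner ?D (gram N Y) = (\<Sum>i\<in>B. \<mu> i * Y 0 $ i)"
      unfolding inner_diag_adj using that by (simp add: feasible_def)
    also have "\<dots> = inner (Y 0) (?D *v 1)"
      by (simp add: inner_vec_def diag_adj_mult if_distrib[of "\<lambda>x. _ * x"] sum.If_cases
          mult.commute cong: if_cong)
    finally show ?thesis .
  qed
  have "inner ?M (gram N (hat X) - gram N (hat P))
      = 2 * inner (block21 ?M) (?E 0)
        + (\<Sum>j<N. inner (X j) (L *v X j) - inner (P j) (L *v P j))
        + (inner ?D (gram N X) - inner ?D (gram N P))"
    by (simp add: inner_diff_right[of ?M] inner_gram_hat[OF Msym N] inner_gram[of ?D] b22
        matrix_vector_mult_add_rdistrib inner_add_right inner_diff_right sum.distrib sum_subtractf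
        del: inner_diff_left)
  also have "(\<Sum>j<N. inner (X j) (L *v X j) - inner (P j) (L *v P j))
      = (\<Sum>j<N. inner (?E j) (L *v ?E j)) + (\<Sum>j<N. 2 * inner (?E j) (L *v P j))"
    by (simp add: symmetric_quadratic_diff[OF Lsym] sum.distrib)
  also have "(\<Sum>j<N. 2 * inner (?E j) (L *v P j)) = - inner (?E 0) q"
    using N by (simp add: lin)
  also have "inner ?D (gram N X) - inner ?D (gram N P) = inner (?E 0) (?D *v 1)"
    by (simp add: diag P X inner_diff_left)
  finally show ?thesis
    by (simp add: b21 q inner_commute inner_add_right inner_diff_right)
qed

text \<open>
  As a function of the Gram matrix the penalty is $\sigma$ times half the squared norm of the projection of
  $\sigma^{-1}\widetilde W$ minus its argument, so its gradient at $\widehat P\widehat P^\top$ is $-W$.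
\<close>

lemma objective_expansion:
  fixes Wt :: "real^('n::finite option)^('n option)" and X P :: "nat \<Rightarrow> real^'n"
  assumes \<sigma>: "\<sigma> > 0"
    and W: "W = \<sigma> *\<^sub>R closest_point (dual_cone K) (inverse \<sigma> *\<^sub>R Wt - gram N (hat P))"
  defines "\<Delta> \<equiv> gram N (hat X) - gram N (hat P)"
  shows "\<bar>objective Q c \<sigma> Wt K N X - objective Q c \<sigma> Wt K N P - inner (cost_mat Q c - W) \<Delta>\<bar>
    \<le> \<sigma> * (norm \<Delta>)\<^sup>2"
proof -
  let ?x = "inverse \<sigma> *\<^sub>R Wt - gram N (hat P)" and ?C = "dual_cone K"
  let ?\<rho> = "(norm (closest_point ?C (?x + - \<Delta>)))\<^sup>2 / 2 - (norm (closest_point ?C ?x))\<^sup>2 / 2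
    - inner (closest_point ?C ?x) (- \<Delta>)"
  have \<rho>: "0 \<le> ?\<rho>" "?\<rho> \<le> (norm \<Delta>)\<^sup>2"
    using half_norm_closest_point_cone_expansion[OF closed_dual_cone convex_cone_dual_cone,
        of K ?x "- \<Delta>"] by simp_all
  have "?x + - \<Delta> = inverse \<sigma> *\<^sub>R Wt - gram N (hat X)"
    by (simp add: \<Delta>_def)
  then have "objective Q c \<sigma> Wt K N X - objective Q c \<sigma> Wt K N P - inner (cost_mat Q c - W) \<Delta> = \<sigma> * ?\<rho>"
    unfolding objective_def by (simp add: W \<Delta>_def inner_diff_left inner_diff_right algebra_simps)
  with \<rho> \<sigma> show ?thesis
    by (simp add: mult_left_mono)
qed

section \<open>Second-order asymptotics along a displacement\<close>

lemma norm_square_smallo: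
  fixes D :: "real \<Rightarrow> real^'k^'l"
  assumes "\<And>i k. (\<lambda>t. D t $ i $ k) \<in> o[F](g)"
  shows "(\<lambda>t. (norm (D t))\<^sup>2) \<in> o[F](\<lambda>t. (g t)\<^sup>2)"
proof -
  have "(norm (D t))\<^sup>2 = (\<Sum>i\<in>UNIV. \<Sum>k\<in>UNIV. D t $ i $ k * D t $ i $ k)" for t
    by (simp add: power2_norm_eq_inner inner_vec_def)
  moreover have "(\<lambda>t. \<Sum>i\<in>UNIV. \<Sum>k\<in>UNIV. D t $ i $ k * D t $ i $ k) \<in> o[F](\<lambda>t. g t * g t)"
    by (intro big_sum_in_smallo landau_o.small_mult assms)
  ultimately show ?thesis
    by (simp add: power2_eq_square)
qed

lemma product_expansion_smallo:
  fixes x y :: "real \<Rightarrow> real"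
  assumes x: "(\<lambda>t. x t - t * u) \<in> O[at 0](\<lambda>t. t\<^sup>2)" and y: "(\<lambda>t. y t - t * v) \<in> O[at 0](\<lambda>t. t\<^sup>2)"
  shows "(\<lambda>t. x t * y t - t\<^sup>2 * (u * v)) \<in> o[at 0](\<lambda>t. t\<^sup>2)"
proof -
  have sq: "(\<lambda>t::real. t\<^sup>2) \<in> o[at 0](\<lambda>t. t)"
    by real_asymp
  have x': "(\<lambda>t. x t - t * u) \<in> o[at 0](\<lambda>t. t)" and y': "(\<lambda>t. y t - t * v) \<in> o[at 0](\<lambda>t. t)"
    using landau_o.big_small_trans[OF x sq] landau_o.big_small_trans[OF y sq] .
  have lin: "(\<lambda>t::real. t * w) \<in> O[at 0](\<lambda>t. t)" for w
    by simp
  have "(\<lambda>t. (x t - t * u) * (t * v) + (t * u) * (y t - t * v) + (x t - t * u) * (y t - t * v))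
      \<in> o[at 0](\<lambda>t. t * t)"
    by (intro sum_in_smallo landau_o.small_big_mult landau_o.big_small_mult landau_o.small_mult
        x' y' lin)
  then show ?thesis
    by (simp add: power2_eq_square algebra_simps)
qed

lemma quadratic_form_expansion_smallo:
  fixes L :: "real^'n^'n" and E :: "real \<Rightarrow> nat \<Rightarrow> real^'n"
  assumes "\<And>j i. j < N \<Longrightarrow> (\<lambda>t. E t j $ i - t * U j $ i) \<in> O[at 0](\<lambda>t. t\<^sup>2)"
  shows "(\<lambda>t. (\<Sum>j<N. inner (E t j) (L *v E t j)) - (\<Sum>j<N. inner (U j) (L *v U j)) * t\<^sup>2)
    \<in> o[at 0](\<lambda>t. t\<^sup>2)"
proof -
  have cmult: "(\<lambda>t. a * f t) \<in> o[at 0](\<lambda>t. t\<^sup>2)" if "f \<in> o[at 0](\<lambda>t. t\<^sup>2)" for a :: real and f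
    using that by simp
  have "(\<lambda>t. \<Sum>j<N. \<Sum>i\<in>UNIV. \<Sum>k\<in>UNIV.
      L $ i $ k * (E t j $ i * E t j $ k - t\<^sup>2 * (U j $ i * U j $ k))) \<in> o[at 0](\<lambda>t. t\<^sup>2)"
    by (intro big_sum_in_smallo cmult product_expansion_smallo assms) auto
  moreover have "(\<Sum>j<N. inner (E t j) (L *v E t j)) - (\<Sum>j<N. inner (U j) (L *v U j)) * t\<^sup>2
      = (\<Sum>j<N. \<Sum>i\<in>UNIV. \<Sum>k\<in>UNIV.
        L $ i $ k * (E t j $ i * E t j $ k - t\<^sup>2 * (U j $ i * U j $ k)))" for t
    by (simp add: inner_vec_def matrix_vector_mult_def sum_distrib_left sum_distrib_right
        sum_subtractf right_diff_distrib mult_ac)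
  ultimately show ?thesis by simp
qed

text \<open>
  The change of a Gram matrix is $\widehat P\widehat E^\top + \widehat E\widehat P^\top + \widehat E\widehat E^\top$,
  where $\widehat E = \widehat X - \widehat P$ has leading row zero. In each column the cross terms have no
  part of first order in $t$: either the velocity $U_j$ or the base column $\widehat P_j$ vanishes.
\<close>

lemma gram_hat_expansion_smallo:
  fixes X :: "real \<Rightarrow> nat \<Rightarrow> real^'n" and P U :: "nat \<Rightarrow> real^'n"
  assumes X: "\<And>j i. j < N \<Longrightarrow> (\<lambda>t. (X t j $ i - P j $ i) - t * U j $ i) \<in> O[at 0](\<lambda>t. t\<^sup>2)"
    and orth: "\<And>j. U j = 0 \<or> hat P j = 0"
  shows "(\<lambda>t. (gram N (hat (X t)) - gram N (hat P)) $ k $ l) \<in> o[at 0](\<lambda>t. t)"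
proof -
  define e where "e t j k = hat (X t) j $ k - hat P j $ k" for t j k
  \<comment> \<open>The leading row of \<open>hat X\<close> is constant, so its velocity is zero.\<close>
  define u where "u j k = (case k of None \<Rightarrow> 0 | Some i \<Rightarrow> U j $ i)" for j k
  have e: "(\<lambda>t. e t j k - t * u j k) \<in> O[at 0](\<lambda>t. t\<^sup>2)" if "j < N" for j k
    using X[OF that] by (cases k) (simp_all add: e_def u_def hat_def)
  have sq: "(\<lambda>t::real. t\<^sup>2) \<in> o[at 0](\<lambda>t. t)"
    by real_asymp
  have mixed: "(\<lambda>t. hat P j $ k * e t j l) \<in> o[at 0](\<lambda>t. t)" if "j < N" for j k l
  proof (cases "U j = 0")
    case True
    then have "u j l = 0"
      by (simp add: u_def split: option.split)
    then have "(\<lambda>t. e t j l) \<in> o[at 0](\<lambda>t. t)"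
      using landau_o.big_small_trans[OF e[OF that, of l] sq] by simp
    then show ?thesis by simp
  next
    case False
    then show ?thesis using orth[of j] by simp
  qed
  have quad: "(\<lambda>t. e t j k * e t j l) \<in> o[at 0](\<lambda>t. t)" if "j < N" for j
  proof -
    have "(\<lambda>t. e t j k * e t j l - t\<^sup>2 * (u j k * u j l)) \<in> o[at 0](\<lambda>t. t)"
      using landau_o.small_trans[OF product_expansion_smallo[OF e[OF that] e[OF that]] sq] .
    moreover have "(\<lambda>t. t\<^sup>2 * (u j k * u j l)) \<in> o[at 0](\<lambda>t. t)"
      using sq by simp
    ultimately have "(\<lambda>t. (e t j k * e t j l - t\<^sup>2 * (u j k * u j l)) + t\<^sup>2 * (u j k * u j l))
        \<in> o[at 0](\<lambda>t. t)"
      by (rule sum_in_smallo)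
    then show ?thesis by simp
  qed
  have "(\<lambda>t. \<Sum>j<N. hat P j $ k * e t j l + hat P j $ l * e t j k + e t j k * e t j l) \<in> o[at 0](\<lambda>t. t)"
    by (intro big_sum_in_smallo sum_in_smallo mixed quad) simp_all
  moreover have "(gram N (hat (X t)) - gram N (hat P)) $ k $ l
      = (\<Sum>j<N. hat P j $ k * e t j l + hat P j $ l * e t j k + e t j k * e t j l)" for t
    by (simp add: gram_def e_def algebra_simps flip: sum_subtractf)
  ultimately show ?thesis by simp
qed

section \<open>Descent along the recovered dual variable\<close>

theorem theorem2:
  fixes Q L J :: "real^'n^'n" and c q :: "real^'n"
    and A :: "real^'n^'m" and b :: "real^'m" and B :: "'n set"
    and \<sigma> :: real
    and Wt W S :: "real^('n option)^('n option)"
    and K :: "(real^('n option)^('n option)) set"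
    and r rbar \<tau> :: nat
    and R U P :: "nat \<Rightarrow> real^'n" and lam :: "nat \<Rightarrow> real^'m" and \<mu> :: "'n \<Rightarrow> real"
    and V :: "nat \<Rightarrow> real^('n option)"
  assumes Q_sym: "transpose Q = Q"
    and A_rank: "rank A = CARD('m)"
    and b_nonneg: "\<forall>k. b $ k \<ge> 0"
    and sigma_pos: "\<sigma> > 0"
    and Wt_sym: "transpose Wt = Wt"
    and K_sym: "\<forall>X\<in>K. transpose X = X"
    and K_polyhedral: "polyhedron K"
    and K_cone: "convex_cone K"
    and rbar_pos: "rbar \<ge> 1"
    and manifold: "\<forall>s\<ge>rbar. feasible A b B s \<noteq> {} \<and> (\<forall>X\<in>feasible A b B s. LICQ A b B s X)"
    and r_ge: "r \<ge> rbar"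
    and R_dim: "R \<in> mats r"
    and lam_dim: "lam \<in> mats r"
    and W_eq: "W = \<sigma> *\<^sub>R closest_point (dual_cone K) (inverse \<sigma> *\<^sub>R Wt - gram r (hat R))"
    and L_eq: "L = Q - diag_adj B \<mu> - block22 W"
    and q_eq: "q = 2 *\<^sub>R c + diag_adj B \<mu> *v 1 - 2 *\<^sub>R block21 W"
    and KKT_stationary:
      "\<forall>j<r. 2 *\<^sub>R (L *v R j) + (if j = 0 then q else 0) - transpose A *v lam j = 0"
    and KKT_affine: "\<forall>j<r. A *v R j = (if j = 0 then b else 0)"
    and KKT_diag: "\<forall>i\<in>B. gram r R $ i $ i - R 0 $ i = 0"
    and J_eq: "J = null_proj A"
    and S_eq: "S = transpose (neg_id (R 0)) ** J ** L ** J ** neg_id (R 0)"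
    and tau_pos: "\<tau> \<ge> 1"
    and V_dim: "V \<in> mats \<tau>"
    and V_eigen: "\<forall>j<\<tau>. V j \<noteq> 0 \<and> (\<exists>\<theta><0. S *v V j = \<theta> *\<^sub>R V j)"
    and U_eq: "U = hcat r (\<lambda>j. 0) (\<lambda>j. (J ** neg_id (R 0)) *v V j)"
    and P_eq: "P = hcat r R (\<lambda>j. 0)"
  shows "P \<in> feasible A b B (r + \<tau>) \<and>
    (\<exists>\<beta><0. (\<lambda>t. objective Q c \<sigma> Wt K (r + \<tau>)
                   (retr (r + \<tau>) (feasible A b B (r + \<tau>)) P (\<lambda>j. t *\<^sub>R U j))
                 - objective Q c \<sigma> Wt K r R - \<beta> * t\<^sup>2)
            \<in> o[at 0](\<lambda>t. t\<^sup>2))"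
proof -
  let ?N = "r + \<tau>"
  let ?F = "feasible A b B ?N"
  define Y where "Y j = (J ** neg_id (R 0)) *v V j" for j
  have r1: "r \<ge> 1"
    using rbar_pos r_ge by simp
  have licq: "LICQ A b B r R" and R: "R \<in> feasible A b B r"
  proof -
    show R: "R \<in> feasible A b B r"
      using R_dim KKT_affine KKT_diag by (simp add: feasible_def)
    then show "LICQ A b B r R"
      using manifold r_ge by blast
  qed
  have U: "U = hcat r (\<lambda>j. 0) Y"
    by (simp add: U_eq Y_def[abs_def])
  have Y: "Y \<in> mats \<tau>" "A *v Y j = 0" for j
    using V_dim null_proj_properties(1)[OF A_rank]
    by (simp_all add: mats_def Y_def J_eq matrix_vector_mul_assoc matrix_mul_assoc)
  have Psum: "gram ?N P = gram r R" "gram ?N (hat P) = gram r (hat R)" "P 0 = R 0"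
  proof -
    have hat_P: "hat P = hcat r (hat R) (\<lambda>j. 0)"
      using r1 by (auto simp: hat_def P_eq hcat_def fun_eq_iff vec_eq_iff split: option.split)
    show "gram ?N P = gram r R" "gram ?N (hat P) = gram r (hat R)"
      unfolding P_eq hat_P[unfolded P_eq] gram_hcat by (simp_all add: gram_def vec_eq_iff)
    show "P 0 = R 0"
      using r1 by (simp add: P_eq hcat_def)
  qed
  have P: "P \<in> ?F"
    using R r1 unfolding feasible_def mem_Collect_eq Psum by (auto simp: mats_def P_eq hcat_def)
  define X where "X t = retr ?N ?F P (\<lambda>j. t *\<^sub>R U j)" for t
  have X: "X t \<in> ?F" for t
    unfolding X_def using P by (intro retr_feasible(1)) blast
  have X_expansion: "(\<lambda>t. (X t j $ i - P j $ i) - t * U j $ i) \<in> O[at 0](\<lambda>t. t\<^sup>2)" if "j < ?N" for i j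
    unfolding X_def U P_eq using that by (intro retr_first_order[OF A_rank licq R r1 Y])
  define \<Delta> where "\<Delta> t = gram ?N (hat (X t)) - gram ?N (hat P)" for t
  have "U j = 0 \<or> hat P j = 0" for j
    using r1 by (simp add: U P_eq hcat_def hat_def vec_eq_iff split: option.split)
  then have "(\<lambda>t. \<Delta> t $ k $ l) \<in> o[at 0](\<lambda>t. t)" for k l
    unfolding \<Delta>_def by (intro gram_hat_expansion_smallo[where U = U] X_expansion) simp_all
  then have \<Delta>: "(\<lambda>t. (norm (\<Delta> t))\<^sup>2) \<in> o[at 0](\<lambda>t. t\<^sup>2)"
    by (rule norm_square_smallo)
  have Wsym: "transpose W = W"
  proof -
    have "closest_point (dual_cone K) (inverse \<sigma> *\<^sub>R Wt - gram r (hat R)) \<in> dual_cone K"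
      using convex_cone_dual_cone[of K]
      by (intro closest_point_in_set closed_dual_cone) (simp add: convex_cone_def)
    then show ?thesis
      by (simp add: W_eq dual_cone_def transpose_scalar)
  qed
  have KKT: "2 *\<^sub>R (L *v P j) + (if j = 0 then q else 0) - transpose A *v lam j = 0" if "j < ?N" for j
  proof (cases "j < r")
    case True
    then show ?thesis
      using KKT_stationary[rule_format, OF True] by (simp add: P_eq hcat_def)
  next
    case False
    then show ?thesis
      using lam_dim r1 by (simp add: P_eq hcat_def mats_def)
  qed
  have linear_part: "inner (cost_mat Q c - W) (\<Delta> t)
      = (\<Sum>j<?N. inner (X t j - P j) (L *v (X t j - P j)))" for t
    unfolding \<Delta>_def using r1
    by (intro objective_linear_part_KKT[OF Q_sym Wsym L_eq q_eq KKT P X]) auto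
  define \<beta> where "\<beta> = (\<Sum>j<?N. inner (U j) (L *v U j))"
  have "\<beta> < 0"
  proof -
    have neg: "inner (Y j) (L *v Y j) < 0" if "j < \<tau>" for j
    proof -
      obtain \<theta> where \<theta>: "\<theta> < 0" "S *v V j = \<theta> *\<^sub>R V j" and "V j \<noteq> 0"
        using V_eigen \<open>j < \<tau>\<close> by blast
      have "transpose J = J"
        unfolding J_eq by (rule null_proj_properties(2)[OF A_rank])
      then have "inner (Y j) (L *v Y j) = inner (neg_id (R 0) *v V j) (J *v (L *v Y j))"
        by (metis Y_def inner_matrix_vector_transpose matrix_vector_mul_assoc)
      also have "\<dots> = inner (V j) (transpose (neg_id (R 0)) *v (J *v (L *v Y j)))"
        by (metis inner_matrix_vector_transpose transpose_transpose)
      also have "\<dots> = inner (V j) (S *v V j)"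
        by (simp only: S_eq Y_def matrix_vector_mul_assoc matrix_mul_assoc)
      finally have "inner (V j) (S *v V j) = inner (Y j) (L *v Y j)" ..
      moreover have "inner (V j) (S *v V j) = \<theta> * (norm (V j))\<^sup>2"
        by (simp add: \<theta>(2) power2_norm_eq_inner)
      ultimately show ?thesis
        using mult_neg_pos[OF \<theta>(1), of "(norm (V j))\<^sup>2"] \<open>V j \<noteq> 0\<close> by simp
    qed
    have "\<beta> = (\<Sum>j<\<tau>. inner (Y j) (L *v Y j))"
      unfolding \<beta>_def U sum_hcat[where g = "\<lambda>v. inner v (L *v v)"] by simp
    also have "\<dots> < (\<Sum>j<\<tau>. 0)"
      using neg tau_pos by (intro sum_strict_mono) (auto simp: lessThan_empty_iff)
    finally show ?thesis by simp
  qed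
  let ?f = "objective Q c \<sigma> Wt K"
  have expansion: "(\<lambda>t. (?f ?N (X t) - ?f ?N P - inner (cost_mat Q c - W) (\<Delta> t))
      + (inner (cost_mat Q c - W) (\<Delta> t) - \<beta> * t\<^sup>2)) \<in> o[at 0](\<lambda>t. t\<^sup>2)"
  proof (rule sum_in_smallo)
    have "\<bar>?f ?N (X t) - ?f ?N P - inner (cost_mat Q c - W) (\<Delta> t)\<bar> \<le> \<sigma> * (norm (\<Delta> t))\<^sup>2" for t
      unfolding \<Delta>_def by (rule objective_expansion[OF sigma_pos]) (simp add: W_eq Psum)
    then have "(\<lambda>t. ?f ?N (X t) - ?f ?N P - inner (cost_mat Q c - W) (\<Delta> t))
        \<in> O[at 0](\<lambda>t. (norm (\<Delta> t))\<^sup>2)"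
      by (intro bigoI[where c = \<sigma>]) simp
    then show "(\<lambda>t. ?f ?N (X t) - ?f ?N P - inner (cost_mat Q c - W) (\<Delta> t)) \<in> o[at 0](\<lambda>t. t\<^sup>2)"
      using \<Delta> by (rule landau_o.big_small_trans)
    show "(\<lambda>t. inner (cost_mat Q c - W) (\<Delta> t) - \<beta> * t\<^sup>2) \<in> o[at 0](\<lambda>t. t\<^sup>2)"
      unfolding linear_part \<beta>_def
      by (rule quadratic_form_expansion_smallo) (simp add: X_expansion)
  qed
  have "?f ?N P = ?f r R"
    unfolding objective_def Psum ..
  then have "?f ?N (X t) - ?f r R - \<beta> * t\<^sup>2
      = (?f ?N (X t) - ?f ?N P - inner (cost_mat Q c - W) (\<Delta> t))
        + (inner (cost_mat Q c - W) (\<Delta> t) - \<beta> * t\<^sup>2)" for t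
    by simp
  then have "(\<lambda>t. ?f ?N (X t) - ?f r R - \<beta> * t\<^sup>2) \<in> o[at 0](\<lambda>t. t\<^sup>2)"
    using expansion by (simp only:)
  with P \<open>\<beta> < 0\<close> show ?thesis
    unfolding X_def by blast
qed

end
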